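(* Let $c>0$ be known and let $(X,U,Y)\in\mathbb{R}^d\times\mathbb{R}^k\times\mathbb{R}^d$ have, given $(\theta,\eta)$, density $$\eta^{d+k/2}\,f\!\left(\eta\left(\|x-\theta\|^2+\|u\|^2+\|y-c\theta\|^2\right)\right),\qquad\theta\in\mathbb{R}^d,\ \eta>0 .$$ Let $(\theta,\eta)$ have prior density $\pi_1(\theta)\,\eta^a$, $a\in\mathbb{R}$, with respect to $d\nu(\theta)\,d\eta$, where $\nu$ is a $\sigma$-finite measure on $\mathbb{R}^d$. Suppose that $\int_{\mathbb{R}_+}t^{d+k/2+a}f(t)\,dt<\infty$ and that the posterior distribution of $(\theta,\eta)$ given $(X,U)=(x,u)$ is well-defined. Then the Bayes predictive density for the conditional density of $Y$ given $(x,u)$ under Kullback-Leibler loss does not depend on the model density $f$ and is given by $$\hat q_{\pi_1}(y;x,u)=\frac{\displaystyle\int_{\mathbb{R}^d}\left(\|x-\theta\|^2+\|u\|^2+\|y-c\theta\|^2\right)^{-n}\pi_1(\theta)\,d\nu(\theta)}{\displaystyle\int_{\mathbb{R}^{2d}}\left(\|x-\theta\|^2+\|u\|^2+\|y-c\theta\|^2\right)^{-n}\pi_1(\theta)\,d\nu(\theta)\,dy},\qquad n=d+\frac k2+a+1 .$$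
   Context: $f:[0,\infty)\to[0,\infty)$ is a known function such that $t\mapsto f(\|t\|^2)$ is a probability density on $\mathbb{R}^{2d+k}$. $\pi_1\ge 0$ is a (not necessarily normalizable, not $\nu$-a.e. zero) density with respect to $\nu$. Let $q_{\theta,\eta}(\cdot|x,u)$ be the conditional density of $Y$ given $(X,U)=(x,u)$ and $p_{\theta,\eta}$ the marginal density of $(X,U)$. The posterior of $(\theta,\eta)$ given $(x,u)$ has density $\pi(\theta,\eta|x,u)$ with respect to $d\nu(\theta)\,d\eta$ proportional to $p_{\theta,\eta}(x,u)\,\pi_1(\theta)\,\eta^a$, and is well-defined when the normalizing constant is finite and positive. The Kullback-Leibler loss of a density $\hat q$ on $\mathbb{R}^d$ is $\int_{\mathbb{R}^d}q_{\theta,\eta}(y|x,u)\log\frac{q_{\theta,\eta}(y|x,u)}{\hat q(y;x,u)}\,dy$; by a result of Aitchison (1975), the Bayes predictive density under this loss is $\hat q_{\pi_1}(y;x,u)=\int q_{\theta,\eta}(y|x,u)\,\pi(\theta,\eta|x,u)\,d\nu(\theta)\,d\eta$, which may be taken as its definition. *)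

theory Defs
  imports "HOL-Analysis.Analysis"
begin

(* The theorem uses sq_resid with a power powr (- n), which is 0 instead of infinite
   where sq_resid vanishes (u = 0, \<theta> = x, y = c *\<^sub>R \<theta>). If u = 0 and the posterior
   is well-defined, the prior gives the point x mass 0, so no integral changes. *)
definition sq_resid :: "real \<Rightarrow> real^'d \<Rightarrow> real^'d \<Rightarrow> real^'k \<Rightarrow> real^'d \<Rightarrow> real" where
  "sq_resid c \<theta> x u y = (norm (x - \<theta>))\<^sup>2 + (norm u)\<^sup>2 + (norm (y - c *\<^sub>R \<theta>))\<^sup>2"

definition joint_density ::
  "(real \<Rightarrow> real) \<Rightarrow> real \<Rightarrow> real^'d \<Rightarrow> real \<Rightarrow> real^'d \<Rightarrow> real^'k \<Rightarrow> real^'d \<Rightarrow> real" where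
  "joint_density f c \<theta> \<eta> x u y =
     \<eta> powr (real CARD('d) + real CARD('k) / 2) * f (\<eta> * sq_resid c \<theta> x u y)"

(* Marginal, conditional and posterior densities are extended nonnegative, because
   for particular (x, u) the marginal may be infinite for some parameters. *)

definition marginal_density ::
  "(real \<Rightarrow> real) \<Rightarrow> real \<Rightarrow> real^'d \<Rightarrow> real \<Rightarrow> real^'d \<Rightarrow> real^'k \<Rightarrow> ennreal" where
  "marginal_density f c \<theta> \<eta> x u = (\<integral>\<^sup>+ y. ennreal (joint_density f c \<theta> \<eta> x u y) \<partial>lborel)"

(* Where the marginal is 0 the value is irrelevant: the posterior density vanishes
   there, and 0 * \<infinity> = 0 in ennreal. If the posterior is well-defined, the marginal
   is infinite only on a set of posterior mass 0. *)
definition cond_density ::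
  "(real \<Rightarrow> real) \<Rightarrow> real \<Rightarrow> real^'d \<Rightarrow> real \<Rightarrow> real^'d \<Rightarrow> real^'k \<Rightarrow> real^'d \<Rightarrow> ennreal" where
  "cond_density f c \<theta> \<eta> x u y =
     ennreal (joint_density f c \<theta> \<eta> x u y) / marginal_density f c \<theta> \<eta> x u"

definition param_measure :: "(real^'d) measure \<Rightarrow> ((real^'d) \<times> real) measure" where
  "param_measure \<nu> = \<nu> \<Otimes>\<^sub>M restrict_space lborel {0<..}"

definition posterior_norm_const ::
  "(real \<Rightarrow> real) \<Rightarrow> real \<Rightarrow> (real^'d) measure \<Rightarrow> (real^'d \<Rightarrow> real) \<Rightarrow> real
     \<Rightarrow> real^'d \<Rightarrow> real^'k \<Rightarrow> ennreal" where
  "posterior_norm_const f c \<nu> \<pi>\<^sub>1 a x u =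
     (\<integral>\<^sup>+ (\<theta>, \<eta>). marginal_density f c \<theta> \<eta> x u * ennreal (\<pi>\<^sub>1 \<theta> * \<eta> powr a) \<partial>param_measure \<nu>)"

definition posterior_well_defined ::
  "(real \<Rightarrow> real) \<Rightarrow> real \<Rightarrow> (real^'d) measure \<Rightarrow> (real^'d \<Rightarrow> real) \<Rightarrow> real
     \<Rightarrow> real^'d \<Rightarrow> real^'k \<Rightarrow> bool" where
  "posterior_well_defined f c \<nu> \<pi>\<^sub>1 a x u \<longleftrightarrow>
     0 < posterior_norm_const f c \<nu> \<pi>\<^sub>1 a x u \<and> posterior_norm_const f c \<nu> \<pi>\<^sub>1 a x u < \<infinity>"

definition posterior_density ::
  "(real \<Rightarrow> real) \<Rightarrow> real \<Rightarrow> (real^'d) measure \<Rightarrow> (real^'d \<Rightarrow> real) \<Rightarrow> real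
     \<Rightarrow> real^'d \<Rightarrow> real^'k \<Rightarrow> real^'d \<Rightarrow> real \<Rightarrow> ennreal" where
  "posterior_density f c \<nu> \<pi>\<^sub>1 a x u \<theta> \<eta> =
     marginal_density f c \<theta> \<eta> x u * ennreal (\<pi>\<^sub>1 \<theta> * \<eta> powr a)
       / posterior_norm_const f c \<nu> \<pi>\<^sub>1 a x u"

(* By Aitchison (1975), the posterior mean of the conditional density is the Bayes
   predictive density under Kullback-Leibler loss; it is taken as the definition. *)
definition bayes_predictive_density ::
  "(real \<Rightarrow> real) \<Rightarrow> real \<Rightarrow> (real^'d) measure \<Rightarrow> (real^'d \<Rightarrow> real) \<Rightarrow> real
     \<Rightarrow> real^'d \<Rightarrow> real^'k \<Rightarrow> real^'d \<Rightarrow> ennreal" where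
  "bayes_predictive_density f c \<nu> \<pi>\<^sub>1 a x u y =
     (\<integral>\<^sup>+ (\<theta>, \<eta>). cond_density f c \<theta> \<eta> x u y * posterior_density f c \<nu> \<pi>\<^sub>1 a x u \<theta> \<eta>
        \<partial>param_measure \<nu>)"

end

theory Submission imports Defs
begin

text \<open>For fixed \<open>\<theta>\<close> and a positive residual \<open>r = sq_resid c \<theta> x u y\<close>, the substitution \<open>t = \<eta> * r\<close> turns
  the integral over \<open>\<eta>\<close> of likelihood times \<open>\<eta> powr a\<close> into \<open>r powr (- n)\<close> times a constant \<open>K\<close>, the
  moment of \<open>f\<close>. By Tonelli the numerator of the posterior mean of the conditional density and the
  normalising constant both carry this factor \<open>K\<close>, which therefore cancels. What remains is to see
  that the points where the marginal is \<open>0\<close> or \<open>\<infinity>\<close>, or where the residual vanishes, do not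
  contribute.\<close>

section \<open>Lebesgue measure on the positive half-line and its scaling\<close>

abbreviation pos_lborel :: "real measure" where
  "pos_lborel \<equiv> restrict_space lborel {0<..}"

lemma measurable_pos_lborel_id [measurable]: "(\<lambda>t. t) \<in> borel_measurable pos_lborel"
  by (intro measurable_restrict_space1) simp

lemma sigma_finite_pos_lborel: "sigma_finite_measure pos_lborel"
  by (intro sigma_finite_measure_restrict_space sigma_finite_lborel) simp

lemma space_pos_lborel [simp]: "space pos_lborel = {0<..}"
  by (simp add: space_restrict_space)

lemma AE_pos_lborel_iff:
  "(AE t in pos_lborel. P t) \<longleftrightarrow> (AE t in lborel. 0 < t \<longrightarrow> P t)"
  by (subst AE_restrict_space_iff) auto

lemma nn_integral_pos_lborel_scale:
  fixes g :: "real \<Rightarrow> ennreal"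
  assumes [measurable]: "g \<in> borel_measurable borel" and "0 < r"
  shows "(\<integral>\<^sup>+ t. g (r * t) \<partial>pos_lborel) = ennreal (1 / r) * (\<integral>\<^sup>+ t. g t \<partial>pos_lborel)"
proof -
  have ind: "indicator {0<..} (r * t) = (indicator {0<..} t :: ennreal)" for t
    using \<open>0 < r\<close> by (auto simp: indicator_def zero_less_mult_iff)
  have "(\<integral>\<^sup>+ t. g t \<partial>pos_lborel) = ennreal r * (\<integral>\<^sup>+ t. g (r * t) \<partial>pos_lborel)"
    using nn_integral_real_affine[of "\<lambda>t. g t * indicator {0<..} t" r 0] \<open>0 < r\<close>
    by (simp add: nn_integral_restrict_space ind)
  then show ?thesis
    using \<open>0 < r\<close> by (simp add: mult.assoc[symmetric] ennreal_mult[symmetric])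
qed

text \<open>Substitution \<open>t = \<eta> * r\<close>: rewriting \<open>\<eta> powr b\<close> in
  terms of \<open>t\<close> costs \<open>r powr - b\<close>, and the Jacobian supplies one more
  factor \<open>1 / r\<close>. Only the constant moment of \<open>f\<close> is left.\<close>

lemma nn_integral_powr_scale:
  fixes f :: "real \<Rightarrow> real"
  assumes [measurable]: "f \<in> borel_measurable borel" and "0 < r"
  shows "(\<integral>\<^sup>+ \<eta>. ennreal (\<eta> powr b * f (\<eta> * r)) \<partial>pos_lborel)
    = ennreal (r powr - (b + 1)) * (\<integral>\<^sup>+ t. ennreal (t powr b * f t) \<partial>pos_lborel)"
proof -
  have "(\<integral>\<^sup>+ \<eta>. ennreal (\<eta> powr b * f (\<eta> * r)) \<partial>pos_lborel)
      = (\<integral>\<^sup>+ \<eta>. ennreal (r powr - b) * ennreal ((r * \<eta>) powr b * f (r * \<eta>)) \<partial>pos_lborel)"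
    using \<open>0 < r\<close>
    by (intro nn_integral_cong)
      (auto simp: ennreal_mult'[symmetric] powr_mult powr_minus field_simps)
  also have "\<dots> = ennreal (r powr - b) * (\<integral>\<^sup>+ \<eta>. ennreal ((r * \<eta>) powr b * f (r * \<eta>)) \<partial>pos_lborel)"
    by (intro nn_integral_cmult) measurable
  also have "\<dots> = ennreal (r powr - b) * (ennreal (1 / r) * (\<integral>\<^sup>+ t. ennreal (t powr b * f t) \<partial>pos_lborel))"
    by (subst nn_integral_pos_lborel_scale[where g = "\<lambda>t. ennreal (t powr b * f t)"])
      (use \<open>0 < r\<close> in auto)
  also have "\<dots> = ennreal (r powr - b * (1 / r)) * (\<integral>\<^sup>+ t. ennreal (t powr b * f t) \<partial>pos_lborel)"
    by (subst ennreal_mult') (simp_all add: mult.assoc)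
  also have "r powr - b * (1 / r) = r powr (- b + - 1)"
    unfolding powr_add using \<open>0 < r\<close> by (simp add: powr_minus_divide)
  also have "- b + - 1 = - (b + 1)"
    by simp
  finally show ?thesis .
qed

section \<open>Radial integrals under dilation, and divergent power integrals\<close>

lemma nn_integral_lborel_scaleR:
  fixes g :: "'a::euclidean_space \<Rightarrow> ennreal"
  assumes [measurable]: "g \<in> borel_measurable borel" and "0 < r"
  shows "(\<integral>\<^sup>+ z. g z \<partial>lborel) = ennreal (r ^ DIM('a)) * (\<integral>\<^sup>+ z. g (t + r *\<^sub>R z) \<partial>lborel)"
  using \<open>0 < r\<close>
  by (subst lborel_affine[of r t])
    (auto simp: nn_integral_density nn_integral_distr nn_integral_cmult)

lemma nn_integral_radial_scale:
  fixes g :: "real \<Rightarrow> ennreal"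
  assumes [measurable]: "g \<in> borel_measurable borel" and "0 < \<eta>"
  shows "(\<integral>\<^sup>+ z. g (\<eta> * (norm (z - p))\<^sup>2) \<partial>(lborel :: 'a::euclidean_space measure))
    = ennreal (\<eta> powr - (real DIM('a) / 2)) * (\<integral>\<^sup>+ z. g ((norm z)\<^sup>2) \<partial>(lborel :: 'a measure))"
proof -
  \<comment> \<open>The dilation factor is chosen so that \<open>\<eta> * r\<^sup>2 = 1\<close>; its
    Jacobian \<open>r ^ DIM('a)\<close> is then the claimed power of \<eta>.\<close>
  define r where "r = \<eta> powr - (1 / 2)"
  have "r\<^sup>2 = \<eta> powr - 1"
    using \<open>0 < \<eta>\<close> by (simp add: r_def powr_realpow[symmetric] powr_powr)
  then have r: "0 < r" "\<eta> * r\<^sup>2 = 1"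
    using \<open>0 < \<eta>\<close> by (simp_all add: r_def powr_minus field_simps)
  have "r ^ DIM('a) = \<eta> powr - (real DIM('a) / 2)"
    using \<open>0 < \<eta>\<close> by (simp add: r_def powr_realpow[symmetric] powr_powr)
  moreover have "\<eta> * (norm (r *\<^sub>R z))\<^sup>2 = (norm z)\<^sup>2" for z :: 'a
    using r by (simp add: power_mult_distrib mult.assoc[symmetric])
  ultimately show ?thesis
    using nn_integral_lborel_scaleR[of "\<lambda>z::'a. g (\<eta> * (norm (z - p))\<^sup>2)" r p] r by simp
qed

text \<open>Instead of polar coordinates: a null set of vectors stays null under every dilation, so Fubini
  over the dilation factor shows that almost every ray meets it in a null set.\<close>

lemma nn_integral_radial_eq_0:
  fixes g :: "real \<Rightarrow> ennreal"
  assumes [measurable]: "g \<in> borel_measurable borel"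
    and zero: "(\<integral>\<^sup>+ z. g ((norm z)\<^sup>2) \<partial>(lborel :: 'a::euclidean_space measure)) = 0"
  shows "(\<integral>\<^sup>+ t. g t \<partial>pos_lborel) = 0"
proof (rule ccontr)
  assume nz: "(\<integral>\<^sup>+ t. g t \<partial>pos_lborel) \<noteq> 0"
  interpret pair_sigma_finite "lborel :: 'a measure" pos_lborel
    by (intro pair_sigma_finite.intro sigma_finite_lborel sigma_finite_pos_lborel)
  have "0 = (\<integral>\<^sup>+ \<eta>. (\<integral>\<^sup>+ z. g (\<eta> * (norm (z - 0))\<^sup>2) \<partial>(lborel :: 'a measure)) \<partial>pos_lborel)"
    by (subst nn_integral_cong[where v = "\<lambda>_. 0"])
      (subst nn_integral_radial_scale, auto simp: zero)
  also have "\<dots> = (\<integral>\<^sup>+ z. (\<integral>\<^sup>+ \<eta>. g (\<eta> * (norm (z - 0))\<^sup>2) \<partial>pos_lborel) \<partial>(lborel :: 'a measure))"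
    by (intro Fubini') measurable
  finally have "AE z::'a in lborel. (\<integral>\<^sup>+ \<eta>. g (\<eta> * (norm z)\<^sup>2) \<partial>pos_lborel) = 0"
    by (subst (asm) eq_commute, subst (asm) nn_integral_0_iff_AE)
      (auto intro!: M2.borel_measurable_nn_integral)
  moreover have "AE z::'a in lborel. z \<noteq> 0"
    by (rule AE_lborel_singleton)
  \<comment> \<open>On the ray through a nonzero \<open>z\<close>, scaling by
    \<open>(norm z)\<^sup>2\<close> turns the inner integral into a positive multiple of the
    integral assumed nonzero.\<close>
  ultimately have "AE z::'a in lborel. False"
  proof eventually_elim
    case (elim z)
    then show False
      using nn_integral_pos_lborel_scale[of g "(norm z)\<^sup>2"] nz
      by (auto simp: mult.commute ennreal_eq_0_iff)
  qed
  then have "emeasure lborel (space lborel :: 'a set) = 0"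
    using AE_iff_measurable[of "space lborel" lborel "\<lambda>_::'a. False"] by auto
  then show False
    by simp
qed

text \<open>The power dominates \<open>1 / t\<close> on one side of \<open>1\<close>: to the right
  if \<open>- 1 \<le> e\<close>, to the left otherwise. The integral of \<open>1 / t\<close> is
  unbounded on both sides.\<close>

lemma nn_integral_powr_pos_lborel: "(\<integral>\<^sup>+ t. ennreal (t powr e) \<partial>pos_lborel) = \<infinity>"
proof -
  have *: "ennreal T \<le> (\<integral>\<^sup>+ t. ennreal (t powr e) \<partial>pos_lborel)" if "0 < T" for T
  proof -
    \<comment> \<open>The interval has logarithmic length exactly \<open>T\<close>, so
      \<open>1 / t\<close> integrates to \<open>T\<close> over it.\<close>
    define l h where "l = (if - 1 \<le> e then 1 else exp (- T))" and "h = (if - 1 \<le> e then exp T else 1)"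
    have lh: "0 < l" "l \<le> h" "ln h - ln l = T"
      using \<open>0 < T\<close> by (auto simp: l_def h_def)
    have "1 / t \<le> t powr e" if "l \<le> t" "t \<le> h" for t
    proof -
      have "0 < t" using that lh by linarith
      moreover have "t powr (- 1) \<le> t powr e"
      proof (cases "- 1 \<le> e")
        case True
        with that show ?thesis by (intro powr_mono) (auto simp: l_def)
      next
        case False
        with that \<open>0 < t\<close> show ?thesis by (intro powr_mono') (auto simp: h_def)
      qed
      ultimately show ?thesis by (simp add: powr_minus_divide)
    qed
    then have "(\<integral>\<^sup>+ t. ennreal (1 / t) * indicator {l..h} t \<partial>lborel)
        \<le> (\<integral>\<^sup>+ t. ennreal (t powr e) * indicator {0<..} t \<partial>lborel)"
      using lh(1) by (intro nn_integral_mono) (auto split: split_indicator intro!: ennreal_leI)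
    moreover have "(\<integral>\<^sup>+ t. ennreal (1 / t) * indicator {l..h} t \<partial>lborel) = ln h - ln l"
      using lh by (intro nn_integral_FTC_Icc) (auto intro!: derivative_eq_intros)
    ultimately show ?thesis
      using lh by (simp add: nn_integral_restrict_space)
  qed
  show ?thesis
  proof (rule ccontr)
    assume "(\<integral>\<^sup>+ t. ennreal (t powr e) \<partial>pos_lborel) \<noteq> \<infinity>"
    then obtain x where x: "0 \<le> x" "(\<integral>\<^sup>+ t. ennreal (t powr e) \<partial>pos_lborel) = ennreal x"
      by (cases "\<integral>\<^sup>+ t. ennreal (t powr e) \<partial>pos_lborel") auto
    with *[of "x + 1"] show False by simp
  qed
qed

section \<open>Measurability and zeros of the marginal density\<close>

lemma measurable_joint_density [measurable]:
  fixes \<theta> y :: "'p \<Rightarrow> real^'d" and x :: "real^'d" and u :: "real^'k"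
  assumes [measurable]: "f \<in> borel_measurable borel"
    "\<theta> \<in> borel_measurable M" "\<eta> \<in> borel_measurable M" "y \<in> borel_measurable M"
  shows "(\<lambda>p. joint_density f c (\<theta> p) (\<eta> p) x u (y p)) \<in> borel_measurable M"
  unfolding joint_density_def sq_resid_def by measurable

lemma measurable_marginal_density [measurable]:
  fixes \<theta> :: "'p \<Rightarrow> real^'d" and x :: "real^'d" and u :: "real^'k"
  assumes [measurable]: "f \<in> borel_measurable borel"
    "\<theta> \<in> borel_measurable M" "\<eta> \<in> borel_measurable M"
  shows "(\<lambda>p. marginal_density f c (\<theta> p) (\<eta> p) x u) \<in> borel_measurable M"
  unfolding marginal_density_def
  by (intro lborel.borel_measurable_nn_integral) measurable

lemma sq_resid_nonneg: "0 \<le> sq_resid c \<theta> x u y"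
  by (simp add: sq_resid_def)

text \<open>Dividing by the marginal is harmless at a \<^emph>\<open>fixed\<close> point \<open>y\<close>: a marginal vanishing at \<open>\<eta>\<^sub>0\<close> forces
  \<open>f = 0\<close> almost everywhere on a half-line, which contains \<open>\<eta> * sq_resid c \<theta> x u y\<close> for all
  \<open>\<eta> > \<eta>\<^sub>0\<close>.\<close>

lemma marginal_density_eq_0_tail:
  fixes x \<theta> y :: "real^'d" and u :: "real^'k"
  assumes [measurable]: "f \<in> borel_measurable borel" and f_nonneg: "\<And>t. 0 \<le> f t"
    and "0 < \<eta>\<^sub>0" and zero: "marginal_density f c \<theta> \<eta>\<^sub>0 x u = 0"
    and r: "0 < sq_resid c \<theta> x u y"
  shows "AE \<eta> in lborel. \<eta>\<^sub>0 < \<eta> \<longrightarrow> f (\<eta> * sq_resid c \<theta> x u y) = 0"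
proof -
  define A where "A = (norm (x - \<theta>))\<^sup>2 + (norm u)\<^sup>2"
  define B where "B = (norm (y - c *\<^sub>R \<theta>))\<^sup>2"
  define s where "s = real CARD('d) + real CARD('k) / 2"
  \<comment> \<open>Cutting off at \<open>\<eta>\<^sub>0 * A\<close> turns the claim about a
    half-line into one about the whole line, where affine substitutions preserve null sets.\<close>
  define F where "F t = ennreal (f t) * indicator {\<eta>\<^sub>0 * A<..} t" for t
  have [measurable]: "F \<in> borel_measurable borel"
    unfolding F_def by measurable
  have AB: "0 \<le> A" "0 \<le> B" "sq_resid c \<theta> x u y = A + B"
    by (simp_all add: A_def B_def sq_resid_def)
  \<comment> \<open>With scale \<open>1\<close> the radial scaling lemma is a pure translation; it
    moves the centre \<open>c *\<^sub>R \<theta>\<close> to the origin.\<close>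
  have "(\<integral>\<^sup>+ z. ennreal (\<eta>\<^sub>0 powr s * f (\<eta>\<^sub>0 * (A + (norm z)\<^sup>2))) \<partial>(lborel :: (real^'d) measure)) = 0"
    using zero nn_integral_radial_scale[where 'a = "real^'d" and \<eta> = 1 and p = "c *\<^sub>R \<theta>"
        and g = "\<lambda>t. ennreal (\<eta>\<^sub>0 powr s * f (\<eta>\<^sub>0 * (A + t)))"]
    by (simp add: marginal_density_def joint_density_def sq_resid_def s_def A_def)
  then have "(\<integral>\<^sup>+ t. ennreal (\<eta>\<^sub>0 powr s * f (\<eta>\<^sub>0 * (A + t))) \<partial>pos_lborel) = 0"
    by (rule nn_integral_radial_eq_0[rotated]) measurable
  then have "AE t in pos_lborel. f (\<eta>\<^sub>0 * (A + t)) = 0"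
    using \<open>0 < \<eta>\<^sub>0\<close> f_nonneg
    by (subst (asm) nn_integral_0_iff_AE) (auto simp: ennreal_eq_0_iff order.antisym mult_le_0_iff)
  then have "AE t in lborel. F (\<eta>\<^sub>0 * A + \<eta>\<^sub>0 * t) = 0"
    unfolding AE_pos_lborel_iff
    by (rule eventually_mono)
      (use \<open>0 < \<eta>\<^sub>0\<close> in \<open>auto simp: F_def distrib_left zero_less_mult_iff split: split_indicator\<close>)
  \<comment> \<open>Two substitutions pass through the integral of \<open>F\<close>: first from the
    squared distance \<open>t\<close> to the argument of \<open>f\<close>, then from that argument
    to \<eta>.\<close>
  then have "(\<integral>\<^sup>+ t. F t \<partial>lborel) = 0"
    using nn_integral_real_affine[of F \<eta>\<^sub>0 "\<eta>\<^sub>0 * A"] \<open>0 < \<eta>\<^sub>0\<close>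
    by (simp add: nn_integral_0_iff_AE)
  then have "AE \<eta> in lborel. F (sq_resid c \<theta> x u y * \<eta>) = 0"
    using nn_integral_real_affine[of F "sq_resid c \<theta> x u y" 0] r
    by (simp add: nn_integral_0_iff_AE ennreal_eq_0_iff)
  then show ?thesis
  proof eventually_elim
    case (elim \<eta>)
    show ?case
    proof
      assume "\<eta>\<^sub>0 < \<eta>"
      have "\<eta>\<^sub>0 * A \<le> \<eta>\<^sub>0 * (A + B)"
        using \<open>0 < \<eta>\<^sub>0\<close> AB by simp
      also have "\<dots> < \<eta> * (A + B)"
        using \<open>\<eta>\<^sub>0 < \<eta>\<close> r AB by simp
      finally show "f (\<eta> * sq_resid c \<theta> x u y) = 0"
        using elim f_nonneg[of "\<eta> * (A + B)"] AB(3)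
        by (auto simp: F_def mult.commute ennreal_eq_0_iff)
    qed
  qed
qed

text \<open>The zeros of the marginal may be uncountable, so the exceptional null sets of the tail
  lemma cannot simply be united. Rational thresholds above some zero are countably many, and they
  cover every zero except possibly the least one, a single point.\<close>

lemma AE_marginal_density_eq_0:
  fixes x \<theta> y :: "real^'d" and u :: "real^'k"
  assumes [measurable]: "f \<in> borel_measurable borel" and f_nonneg: "\<And>t. 0 \<le> f t"
    and r: "0 < sq_resid c \<theta> x u y"
  shows "AE \<eta> in pos_lborel.
    marginal_density f c \<theta> \<eta> x u = 0 \<longrightarrow> f (\<eta> * sq_resid c \<theta> x u y) = 0"
proof -
  define S where "S = {\<eta>. 0 < \<eta> \<and> marginal_density f c \<theta> \<eta> x u = 0}"
  have "AE \<eta> in lborel. q < \<eta> \<longrightarrow> f (\<eta> * sq_resid c \<theta> x u y) = 0"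
    if "\<eta>\<^sub>0 \<in> S" "\<eta>\<^sub>0 < q" for \<eta>\<^sub>0 q
    using marginal_density_eq_0_tail[of f \<eta>\<^sub>0 c \<theta> x u y] that f_nonneg r
    by (auto simp: S_def elim!: eventually_mono)
  then have "AE \<eta> in lborel. \<forall>q\<in>{q\<in>\<rat>. \<exists>\<eta>\<^sub>0\<in>S. \<eta>\<^sub>0 < q}. q < \<eta> \<longrightarrow> f (\<eta> * sq_resid c \<theta> x u y) = 0"
    by (subst AE_ball_countable) (auto intro: countable_subset[OF _ countable_rat])
  moreover have "AE \<eta> in lborel. \<eta> \<noteq> Inf S"
    by (rule AE_lborel_singleton)
  ultimately show ?thesis
    unfolding AE_pos_lborel_iff
  proof eventually_elim
    case (elim \<eta>)
    show ?case
    proof (intro impI)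
      assume "0 < \<eta>" "marginal_density f c \<theta> \<eta> x u = 0"
      then have "\<eta> \<in> S" by (simp add: S_def)
      then obtain \<eta>\<^sub>0 where "\<eta>\<^sub>0 \<in> S" "\<eta>\<^sub>0 < \<eta>"
        using elim(2) cInf_eq_minimum[of \<eta> S] by (metis not_le)
      moreover obtain q where "q \<in> \<rat>" "\<eta>\<^sub>0 < q" "q < \<eta>"
        using Rats_dense_in_real[OF \<open>\<eta>\<^sub>0 < \<eta>\<close>] by blast
      ultimately show "f (\<eta> * sq_resid c \<theta> x u y) = 0"
        using elim(1) by blast
    qed
  qed
qed

text \<open>Cancelling \<open>M\<close> in \<open>ennreal\<close> requires \<open>M\<close> to be
  neither \<open>0\<close> nor infinite. For nonzero \<open>w\<close>, finiteness of
  \<open>M * w\<close> excludes infinity; the second hypothesis makes both sides vanish when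
  \<open>M = 0\<close>.\<close>

lemma predictive_integrand_eq:
  fixes J M w Z :: ennreal
  assumes "M * w \<noteq> \<infinity>" and "M = 0 \<Longrightarrow> J * w = 0"
  shows "(J / M) * (M * w / Z) = J * w / Z"
proof (cases "M = 0 \<or> w = 0")
  case True
  with assms show ?thesis by auto
next
  case False
  with assms have "M < top"
    by (auto simp: ennreal_mult_eq_top_iff less_top)
  have "(J / M) * (M * w / Z) = (M / M) * (J * w / Z)"
    by (simp add: divide_ennreal_def mult_ac)
  with False \<open>M < top\<close> show ?thesis
    by (simp add: ennreal_divide_self)
qed

section \<open>The model at a fixed observation\<close>

text \<open>Measurability and nonnegativity of \<open>f\<close> are demanded on the whole real line,
  which is more than the theorem grants; the theorem instantiates the locale with a modified
  \<open>f\<close>.\<close>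

locale spherical_model =
  fixes f :: "real \<Rightarrow> real" and c a :: real
    and \<nu> :: "(real^'d) measure" and \<pi>\<^sub>1 :: "real^'d \<Rightarrow> real"
    and x :: "real^'d" and u :: "real^'k"
  assumes f_measurable [measurable]: "f \<in> borel_measurable borel"
    and f_nonneg: "0 \<le> f t"
    and sigma_finite_\<nu>: "sigma_finite_measure \<nu>"
    and sets_\<nu> [measurable_cong]: "sets \<nu> = sets borel"
    and prior_measurable [measurable]: "\<pi>\<^sub>1 \<in> borel_measurable \<nu>"
    and prior_nonneg: "0 \<le> \<pi>\<^sub>1 \<theta>"
    and well_defined: "posterior_well_defined f c \<nu> \<pi>\<^sub>1 a x u"
    and moment_finite: "(\<integral>\<^sup>+ t. ennreal (t powr (real CARD('d) + real CARD('k) / 2 + a) * f t) \<partial>pos_lborel) < \<infinity>"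
begin

text \<open>The total exponent of \<eta> in likelihood times prior. Integrating out \<eta> raises it
  by one, so \<open>n\<close> in the theorem is \<open>b + 1\<close>.\<close>

definition b :: real where "b = real CARD('d) + real CARD('k) / 2 + a"

abbreviation w :: "real^'d \<Rightarrow> real \<Rightarrow> ennreal" where
  "w \<theta> \<eta> \<equiv> ennreal (\<pi>\<^sub>1 \<theta> * \<eta> powr a)"

abbreviation J :: "real^'d \<Rightarrow> real \<Rightarrow> real^'d \<Rightarrow> ennreal" where
  "J \<theta> \<eta> y \<equiv> ennreal (joint_density f c \<theta> \<eta> x u y)"

abbreviation M :: "real^'d \<Rightarrow> real \<Rightarrow> ennreal" where
  "M \<theta> \<eta> \<equiv> marginal_density f c \<theta> \<eta> x u"

abbreviation r :: "real^'d \<Rightarrow> real^'d \<Rightarrow> real" where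
  "r \<theta> y \<equiv> sq_resid c \<theta> x u y"

abbreviation Z :: ennreal where
  "Z \<equiv> posterior_norm_const f c \<nu> \<pi>\<^sub>1 a x u"

definition K :: ennreal where
  "K = (\<integral>\<^sup>+ t. ennreal (t powr b * f t) \<partial>pos_lborel)"

sublocale R: sigma_finite_measure pos_lborel
  by (rule sigma_finite_pos_lborel)

sublocale \<nu>R: pair_sigma_finite \<nu> pos_lborel
  by (intro pair_sigma_finite.intro sigma_finite_\<nu> sigma_finite_pos_lborel)

sublocale RL: pair_sigma_finite pos_lborel "lborel :: (real^'d) measure"
  by (intro pair_sigma_finite.intro sigma_finite_lborel sigma_finite_pos_lborel)

lemma snd_measurable [measurable]: "(\<lambda>p. snd p) \<in> borel_measurable (N \<Otimes>\<^sub>M pos_lborel)"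
  using measurable_comp[OF measurable_snd measurable_pos_lborel_id, of N] by (simp add: comp_def)

lemma fst_measurable [measurable]: "(\<lambda>p. fst p) \<in> borel_measurable (pos_lborel \<Otimes>\<^sub>M N)"
  using measurable_comp[OF measurable_fst measurable_pos_lborel_id, of N] by (simp add: comp_def)

section \<open>Integrating out the scale parameter\<close>

lemma Z_eq: "Z = (\<integral>\<^sup>+ \<theta>. (\<integral>\<^sup>+ \<eta>. M \<theta> \<eta> * w \<theta> \<eta> \<partial>pos_lborel) \<partial>\<nu>)"
  unfolding posterior_norm_const_def param_measure_def
  by (subst R.nn_integral_fst[symmetric]) (auto simp: case_prod_beta)

lemma J_mult_w:
  assumes "0 < \<eta>"
  shows "J \<theta> \<eta> y * w \<theta> \<eta> = ennreal (\<pi>\<^sub>1 \<theta>) * ennreal (\<eta> powr b * f (\<eta> * r \<theta> y))"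
proof -
  have "J \<theta> \<eta> y * w \<theta> \<eta> = ennreal (joint_density f c \<theta> \<eta> x u y * (\<pi>\<^sub>1 \<theta> * \<eta> powr a))"
    using prior_nonneg[of \<theta>] by (simp add: ennreal_mult'')
  also have "joint_density f c \<theta> \<eta> x u y * (\<pi>\<^sub>1 \<theta> * \<eta> powr a) = \<pi>\<^sub>1 \<theta> * (\<eta> powr b * f (\<eta> * r \<theta> y))"
    by (simp add: joint_density_def b_def powr_add)
  also have "ennreal \<dots> = ennreal (\<pi>\<^sub>1 \<theta>) * ennreal (\<eta> powr b * f (\<eta> * r \<theta> y))"
    using prior_nonneg[of \<theta>] by (simp add: ennreal_mult')
  finally show ?thesis .
qed

lemma integral_J_mult_w:
  assumes "0 < r \<theta> y"
  shows "(\<integral>\<^sup>+ \<eta>. J \<theta> \<eta> y * w \<theta> \<eta> \<partial>pos_lborel) = ennreal (r \<theta> y powr - (b + 1) * \<pi>\<^sub>1 \<theta>) * K"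
proof -
  have "(\<integral>\<^sup>+ \<eta>. J \<theta> \<eta> y * w \<theta> \<eta> \<partial>pos_lborel)
      = (\<integral>\<^sup>+ \<eta>. ennreal (\<pi>\<^sub>1 \<theta>) * ennreal (\<eta> powr b * f (\<eta> * r \<theta> y)) \<partial>pos_lborel)"
    by (intro nn_integral_cong) (simp add: J_mult_w)
  also have "\<dots> = ennreal (\<pi>\<^sub>1 \<theta>) * (\<integral>\<^sup>+ \<eta>. ennreal (\<eta> powr b * f (\<eta> * r \<theta> y)) \<partial>pos_lborel)"
    by (intro nn_integral_cmult) measurable
  also have "\<dots> = ennreal (r \<theta> y powr - (b + 1) * \<pi>\<^sub>1 \<theta>) * K"
    using assms prior_nonneg[of \<theta>]
    by (simp add: nn_integral_powr_scale K_def ennreal_mult mult_ac)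
  finally show ?thesis .
qed

text \<open>For fixed \<theta> only the point \<open>y = c *\<^sub>R \<theta>\<close> can be
  exceptional. With \<open>y\<close> fixed and \<theta> varying, \<nu> may have atoms, and
  \<open>AE_resid_eq_0\<close> takes over this role.\<close>

lemma AE_resid_pos: "AE y in lborel. 0 < r \<theta> y"
  using AE_lborel_singleton[of "c *\<^sub>R \<theta>"]
  by eventually_elim (auto simp: sq_resid_def intro!: add_nonneg_pos)

lemma integral_M_mult_w:
  "(\<integral>\<^sup>+ \<eta>. M \<theta> \<eta> * w \<theta> \<eta> \<partial>pos_lborel)
    = (\<integral>\<^sup>+ y. ennreal (r \<theta> y powr - (b + 1) * \<pi>\<^sub>1 \<theta>) \<partial>lborel) * K"
proof -
  have "(\<integral>\<^sup>+ \<eta>. M \<theta> \<eta> * w \<theta> \<eta> \<partial>pos_lborel)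
      = (\<integral>\<^sup>+ \<eta>. (\<integral>\<^sup>+ y. J \<theta> \<eta> y * w \<theta> \<eta> \<partial>lborel) \<partial>pos_lborel)"
    unfolding marginal_density_def by (intro nn_integral_cong nn_integral_multc[symmetric]) measurable
  also have "\<dots> = (\<integral>\<^sup>+ y. (\<integral>\<^sup>+ \<eta>. J \<theta> \<eta> y * w \<theta> \<eta> \<partial>pos_lborel) \<partial>lborel)"
    by (intro RL.Fubini'[symmetric]) measurable
  also have "\<dots> = (\<integral>\<^sup>+ y. ennreal (r \<theta> y powr - (b + 1) * \<pi>\<^sub>1 \<theta>) * K \<partial>lborel)"
    using AE_resid_pos[of \<theta>] by (intro nn_integral_cong_AE) (auto simp: integral_J_mult_w)
  also have "\<dots> = (\<integral>\<^sup>+ y. ennreal (r \<theta> y powr - (b + 1) * \<pi>\<^sub>1 \<theta>) \<partial>lborel) * K"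
    unfolding sq_resid_def by (intro nn_integral_multc) measurable
  finally show ?thesis .
qed

definition D :: ennreal where
  "D = (\<integral>\<^sup>+ (\<theta>, y). ennreal (r \<theta> y powr - (b + 1) * \<pi>\<^sub>1 \<theta>) \<partial>(\<nu> \<Otimes>\<^sub>M lborel))"

lemma Z_eq_D_mult_K: "Z = D * K"
proof -
  have "Z = (\<integral>\<^sup>+ \<theta>. (\<integral>\<^sup>+ y. ennreal (r \<theta> y powr - (b + 1) * \<pi>\<^sub>1 \<theta>) \<partial>lborel) * K \<partial>\<nu>)"
    unfolding Z_eq integral_M_mult_w ..
  also have "\<dots> = (\<integral>\<^sup>+ \<theta>. (\<integral>\<^sup>+ y. ennreal (r \<theta> y powr - (b + 1) * \<pi>\<^sub>1 \<theta>) \<partial>lborel) \<partial>\<nu>) * K"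
    unfolding sq_resid_def by (intro nn_integral_multc) measurable
  also have "\<dots> = D * K"
    unfolding D_def sq_resid_def by (subst lborel.nn_integral_fst[symmetric]) (auto simp: case_prod_beta)
  finally show ?thesis .
qed

lemma Z_bounds: "0 < Z" "Z < \<infinity>"
  using well_defined by (auto simp: posterior_well_defined_def)

text \<open>Positivity comes from the factorisation, since \<open>K = 0\<close> would force
  \<open>Z = 0\<close>; finiteness is the moment hypothesis.\<close>

lemma K_bounds: "0 < K" "K < \<infinity>"
  using moment_finite Z_bounds by (auto simp: K_def b_def Z_eq_D_mult_K zero_less_iff_neq_zero)

lemma D_bounds: "0 < D" "D < \<infinity>"
  using Z_bounds K_bounds by (auto simp: Z_eq_D_mult_K ennreal_mult_less_top zero_less_iff_neq_zero)

text \<open>If the residual can vanish, the marginal at \<open>\<theta> = x\<close> is a pure power of \<open>\<eta>\<close>, which is not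
  integrable on the half-line for any exponent; so the posterior could not be normalised if the
  prior charged \<open>x\<close>.\<close>

lemma AE_resid_eq_0: "AE \<theta> in \<nu>. r \<theta> y = 0 \<longrightarrow> \<pi>\<^sub>1 \<theta> = 0"
proof -
  define C where "C = (\<integral>\<^sup>+ z. ennreal (f ((norm z)\<^sup>2)) \<partial>(lborel :: (real^'d) measure))"
  \<comment> \<open>If \<open>C\<close> were \<open>0\<close>, then \<open>f\<close> would vanish
    almost everywhere on the half-line, contradicting \<open>0 < K\<close>.\<close>
  have "C \<noteq> 0"
  proof
    assume "C = 0"
    then have "(\<integral>\<^sup>+ t. ennreal (f t) \<partial>pos_lborel) = 0"
      unfolding C_def by (rule nn_integral_radial_eq_0[rotated]) measurable
    then have "AE t in pos_lborel. ennreal (f t) = 0"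
      by (subst (asm) nn_integral_0_iff_AE) auto
    then have "K = 0"
      unfolding K_def by (subst nn_integral_0_iff_AE) (auto elim!: eventually_mono simp: ennreal_eq_0_iff mult_le_0_iff)
    with K_bounds show False by simp
  qed
  have infinite: "(\<integral>\<^sup>+ \<eta>. M \<theta> \<eta> * w \<theta> \<eta> \<partial>pos_lborel) = \<infinity>"
    if "r \<theta> y = 0" "\<pi>\<^sub>1 \<theta> \<noteq> 0" for \<theta>
  proof -
    \<comment> \<open>Integrating over \<open>z\<close> in dimension \<open>CARD('d)\<close> lowers
      the exponent \<open>b\<close> by half the dimension.\<close>
    define e where "e = b - real CARD('d) / 2"
    have resid: "r \<theta> z = (norm (z - c *\<^sub>R \<theta>))\<^sup>2" for z
      using that(1) by (simp add: sq_resid_def add_nonneg_eq_0_iff)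
    have "M \<theta> \<eta> * w \<theta> \<eta> = (ennreal (\<pi>\<^sub>1 \<theta>) * C) * ennreal (\<eta> powr e)" if "0 < \<eta>" for \<eta>
    proof -
      have "M \<theta> \<eta> * w \<theta> \<eta> = (\<integral>\<^sup>+ z. J \<theta> \<eta> z * w \<theta> \<eta> \<partial>lborel)"
        unfolding marginal_density_def by (intro nn_integral_multc[symmetric]) measurable
      also have "\<dots> = (\<integral>\<^sup>+ z. ennreal (\<pi>\<^sub>1 \<theta> * \<eta> powr b) * ennreal (f (\<eta> * (norm (z - c *\<^sub>R \<theta>))\<^sup>2)) \<partial>lborel)"
        unfolding J_mult_w[OF \<open>0 < \<eta>\<close>] resid using prior_nonneg[of \<theta>]
        by (simp add: ennreal_mult' mult.assoc)
      also have "\<dots> = ennreal (\<pi>\<^sub>1 \<theta> * \<eta> powr b) * (\<integral>\<^sup>+ z. ennreal (f (\<eta> * (norm (z - c *\<^sub>R \<theta>))\<^sup>2)) \<partial>lborel)"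
        by (intro nn_integral_cmult) measurable
      also have "\<dots> = ennreal (\<pi>\<^sub>1 \<theta> * \<eta> powr b) * (ennreal (\<eta> powr - (real CARD('d) / 2)) * C)"
        using nn_integral_radial_scale[where 'a = "real^'d" and g = "\<lambda>t. ennreal (f t)" and p = "c *\<^sub>R \<theta>", of \<eta>] \<open>0 < \<eta>\<close>
        by (simp add: C_def)
      also have "\<dots> = (ennreal (\<pi>\<^sub>1 \<theta>) * C) * ennreal (\<eta> powr b * \<eta> powr - (real CARD('d) / 2))"
        using prior_nonneg[of \<theta>] by (simp add: ennreal_mult mult_ac)
      finally show ?thesis
        by (simp add: e_def powr_add[symmetric])
    qed
    then have "(\<integral>\<^sup>+ \<eta>. M \<theta> \<eta> * w \<theta> \<eta> \<partial>pos_lborel)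
        = (\<integral>\<^sup>+ \<eta>. (ennreal (\<pi>\<^sub>1 \<theta>) * C) * ennreal (\<eta> powr e) \<partial>pos_lborel)"
      by (intro nn_integral_cong) simp
    also have "\<dots> = (ennreal (\<pi>\<^sub>1 \<theta>) * C) * (\<integral>\<^sup>+ \<eta>. ennreal (\<eta> powr e) \<partial>pos_lborel)"
      by (intro nn_integral_cmult) measurable
    also have "\<dots> = \<infinity>"
      using \<open>C \<noteq> 0\<close> that(2) prior_nonneg[of \<theta>]
      by (simp add: nn_integral_powr_pos_lborel ennreal_mult_top ennreal_eq_0_iff order.antisym)
    finally show ?thesis .
  qed
  have "(\<integral>\<^sup>+ \<theta>. (\<integral>\<^sup>+ \<eta>. M \<theta> \<eta> * w \<theta> \<eta> \<partial>pos_lborel) \<partial>\<nu>) \<noteq> \<infinity>"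
    using Z_bounds unfolding Z_eq by simp
  then have "AE \<theta> in \<nu>. (\<integral>\<^sup>+ \<eta>. M \<theta> \<eta> * w \<theta> \<eta> \<partial>pos_lborel) \<noteq> \<infinity>"
    by (intro nn_integral_PInf_AE) measurable
  then show ?thesis
    by eventually_elim (use infinite in blast)
qed

text \<open>Argued fibrewise in \<theta>: a zero residual makes the prior weight vanish for almost
  every \<theta>, and a positive residual is covered by the result on zeros of the marginal. This
  supplies the second hypothesis of \<open>predictive_integrand_eq\<close>.\<close>

lemma AE_M_eq_0: "AE (\<theta>, \<eta>) in \<nu> \<Otimes>\<^sub>M pos_lborel. M \<theta> \<eta> = 0 \<longrightarrow> J \<theta> \<eta> y * w \<theta> \<eta> = 0"
proof (rule \<nu>R.AE_pair_measure)
  show "{p \<in> space (\<nu> \<Otimes>\<^sub>M pos_lborel). case p of (\<theta>, \<eta>) \<Rightarrow> M \<theta> \<eta> = 0 \<longrightarrow> J \<theta> \<eta> y * w \<theta> \<eta> = 0}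
      \<in> sets (\<nu> \<Otimes>\<^sub>M pos_lborel)"
    unfolding case_prod_beta by measurable
  show "AE \<theta> in \<nu>. AE \<eta> in pos_lborel. case (\<theta>, \<eta>) of (\<theta>, \<eta>) \<Rightarrow> M \<theta> \<eta> = 0 \<longrightarrow> J \<theta> \<eta> y * w \<theta> \<eta> = 0"
    using AE_resid_eq_0[of y]
  proof eventually_elim
    case (elim \<theta>)
    show ?case
    proof (cases "r \<theta> y = 0")
      case False
      then have "0 < r \<theta> y"
        using sq_resid_nonneg[of c \<theta> x u y] by linarith
      from AE_marginal_density_eq_0[OF f_measurable f_nonneg this] show ?thesis
        by eventually_elim (auto simp: joint_density_def)
    qed (use elim in simp)
  qed
qed

lemma predictive_eq:
  "bayes_predictive_density f c \<nu> \<pi>\<^sub>1 a x u y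
    = (\<integral>\<^sup>+ \<theta>. ennreal (r \<theta> y powr - (b + 1) * \<pi>\<^sub>1 \<theta>) \<partial>\<nu>) / D"
proof -
  define N where "N = (\<integral>\<^sup>+ \<theta>. ennreal (r \<theta> y powr - (b + 1) * \<pi>\<^sub>1 \<theta>) \<partial>\<nu>)"
  \<comment> \<open>Finiteness of \<open>Z\<close> makes the unnormalised posterior density finite
    almost everywhere, the first hypothesis of \<open>predictive_integrand_eq\<close>.\<close>
  have "(\<integral>\<^sup>+ (\<theta>, \<eta>). M \<theta> \<eta> * w \<theta> \<eta> \<partial>(\<nu> \<Otimes>\<^sub>M pos_lborel)) \<noteq> \<infinity>"
    using Z_bounds by (simp add: posterior_norm_const_def param_measure_def)
  then have "AE (\<theta>, \<eta>) in \<nu> \<Otimes>\<^sub>M pos_lborel. M \<theta> \<eta> * w \<theta> \<eta> \<noteq> \<infinity>"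
    unfolding case_prod_beta by (intro nn_integral_PInf_AE) measurable
  with AE_M_eq_0[of y]
  have "AE (\<theta>, \<eta>) in \<nu> \<Otimes>\<^sub>M pos_lborel.
      cond_density f c \<theta> \<eta> x u y * posterior_density f c \<nu> \<pi>\<^sub>1 a x u \<theta> \<eta> = J \<theta> \<eta> y * w \<theta> \<eta> / Z"
    by eventually_elim
      (auto simp: cond_density_def posterior_density_def intro!: predictive_integrand_eq)
  then have "bayes_predictive_density f c \<nu> \<pi>\<^sub>1 a x u y
      = (\<integral>\<^sup>+ (\<theta>, \<eta>). J \<theta> \<eta> y * w \<theta> \<eta> / Z \<partial>(\<nu> \<Otimes>\<^sub>M pos_lborel))"
    unfolding bayes_predictive_density_def param_measure_def
    by (intro nn_integral_cong_AE) (auto elim!: eventually_mono)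
  also have "\<dots> = (\<integral>\<^sup>+ (\<theta>, \<eta>). J \<theta> \<eta> y * w \<theta> \<eta> \<partial>(\<nu> \<Otimes>\<^sub>M pos_lborel)) / Z"
    unfolding case_prod_beta by (intro nn_integral_divide) measurable
  also have "(\<integral>\<^sup>+ (\<theta>, \<eta>). J \<theta> \<eta> y * w \<theta> \<eta> \<partial>(\<nu> \<Otimes>\<^sub>M pos_lborel))
      = (\<integral>\<^sup>+ \<theta>. (\<integral>\<^sup>+ \<eta>. J \<theta> \<eta> y * w \<theta> \<eta> \<partial>pos_lborel) \<partial>\<nu>)"
    by (subst R.nn_integral_fst[symmetric]) (auto simp: case_prod_beta)
  also have "\<dots> = (\<integral>\<^sup>+ \<theta>. ennreal (r \<theta> y powr - (b + 1) * \<pi>\<^sub>1 \<theta>) * K \<partial>\<nu>)"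
  proof (rule nn_integral_cong_AE)
    show "AE \<theta> in \<nu>. (\<integral>\<^sup>+ \<eta>. J \<theta> \<eta> y * w \<theta> \<eta> \<partial>pos_lborel)
        = ennreal (r \<theta> y powr - (b + 1) * \<pi>\<^sub>1 \<theta>) * K"
      using AE_resid_eq_0[of y]
    proof eventually_elim
      case (elim \<theta>)
      show ?case
      \<comment> \<open>Where the residual is \<open>0\<close>, the prior density is
        \<open>0\<close> as well, so both sides vanish.\<close>
      proof (cases "r \<theta> y = 0")
        case False
        then show ?thesis
          using sq_resid_nonneg[of c \<theta> x u y] by (intro integral_J_mult_w) linarith
      qed (use elim in simp)
    qed
  qed
  also have "\<dots> = N * K"
    unfolding N_def sq_resid_def by (intro nn_integral_multc) measurable
  \<comment> \<open>Splitting the inverse of \<open>D * K\<close> and cancelling \<open>K\<close>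
    are legitimate in \<open>ennreal\<close> because both factors are positive and finite.\<close>
  also have "N * K / Z = (K / K) * (N / D)"
    using D_bounds K_bounds
    by (simp add: Z_eq_D_mult_K divide_ennreal_def ennreal_inverse_mult mult_ac)
  also have "K / K = 1"
    using K_bounds by (intro ennreal_divide_self) auto
  finally show ?thesis
    by (simp add: N_def)
qed

end

section \<open>Reduction of the theorem to the locale\<close>

text \<open>Composing the radial function with \<open>sqrt (max 0 t) *\<^sub>R e\<close> for a unit
  vector \<open>e\<close> recovers \<open>f\<close> on the nonnegative axis.\<close>

lemma measurable_of_radial:
  fixes f :: "real \<Rightarrow> real"
  assumes "(\<lambda>t :: 'a::euclidean_space. f ((norm t)\<^sup>2)) \<in> borel_measurable borel"
  shows "(\<lambda>t. f (max 0 t)) \<in> borel_measurable borel"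
proof -
  obtain e :: 'a where e: "e \<in> Basis"
    using nonempty_Basis by blast
  have "(\<lambda>t::real. sqrt (max 0 t) *\<^sub>R e) \<in> borel_measurable borel"
    by measurable
  from measurable_compose[OF this assms] show ?thesis
    using e by simp
qed

lemma param_measure_pos: "p \<in> space (param_measure \<nu>) \<Longrightarrow> 0 < snd p"
  by (auto simp: param_measure_def space_pair_measure)

theorem theorem3p3:
  fixes f :: "real \<Rightarrow> real"
    and c a n :: real
    and \<nu> :: "(real^'d) measure"
    and \<pi>\<^sub>1 :: "real^'d \<Rightarrow> real"
    and x y :: "real^'d"
    and u :: "real^'k"
  assumes "\<And>t. 0 \<le> t \<Longrightarrow> 0 \<le> f t"
    and "(\<lambda>t :: (real^'d) \<times> (real^'k) \<times> (real^'d). f ((norm t)\<^sup>2)) \<in> borel_measurable borel"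
    and "(\<integral>\<^sup>+ t. ennreal (f ((norm t)\<^sup>2))
           \<partial>(lborel :: ((real^'d) \<times> (real^'k) \<times> (real^'d)) measure)) = 1"
    and "0 < c"
    and "sigma_finite_measure \<nu>"
    and "sets \<nu> = sets borel"
    and "\<pi>\<^sub>1 \<in> borel_measurable \<nu>"
    and "\<And>\<theta>. 0 \<le> \<pi>\<^sub>1 \<theta>"
    and "\<not> (AE \<theta> in \<nu>. \<pi>\<^sub>1 \<theta> = 0)"
    and "(\<integral>\<^sup>+ t\<in>{0<..}. ennreal (t powr (real CARD('d) + real CARD('k) / 2 + a) * f t) \<partial>lborel) < \<infinity>"
    and "posterior_well_defined f c \<nu> \<pi>\<^sub>1 a x u"
    and "n = real CARD('d) + real CARD('k) / 2 + a + 1"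
  shows "let N = (\<integral>\<^sup>+ \<theta>. ennreal (sq_resid c \<theta> x u y powr (- n) * \<pi>\<^sub>1 \<theta>) \<partial>\<nu>);
             D = (\<integral>\<^sup>+ (\<theta>, y'). ennreal (sq_resid c \<theta> x u y' powr (- n) * \<pi>\<^sub>1 \<theta>) \<partial>(\<nu> \<Otimes>\<^sub>M lborel))
         in 0 < D \<and> D < \<infinity> \<and> bayes_predictive_density f c \<nu> \<pi>\<^sub>1 a x u y = N / D"
proof -
  \<comment> \<open>The hypotheses say nothing about \<open>f\<close> on the negative axis, not even measurability.\<close>
  define F where "F t = f (max 0 t)" for t
  have joint: "joint_density F c \<theta> \<eta> x u z = joint_density f c \<theta> \<eta> x u z"
    if "0 < \<eta>" for \<theta> \<eta> z
    using that sq_resid_nonneg[of c \<theta> x u z]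
    by (simp add: joint_density_def F_def)
  then have marginal: "marginal_density F c \<theta> \<eta> x u = marginal_density f c \<theta> \<eta> x u"
    if "0 < \<eta>" for \<theta> \<eta>
    using that by (simp add: marginal_density_def)
  \<comment> \<open>Only positive \<eta> lie in the parameter space, and there \<open>F\<close> and
    \<open>f\<close> give the same densities.\<close>
  have norm_const: "posterior_norm_const F c \<nu> \<pi>\<^sub>1 a x u = posterior_norm_const f c \<nu> \<pi>\<^sub>1 a x u"
    unfolding posterior_norm_const_def
    by (intro nn_integral_cong) (auto simp: marginal dest: param_measure_pos)
  have predictive: "bayes_predictive_density F c \<nu> \<pi>\<^sub>1 a x u y = bayes_predictive_density f c \<nu> \<pi>\<^sub>1 a x u y"
    unfolding bayes_predictive_density_def cond_density_def posterior_density_def norm_const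
    by (intro nn_integral_cong) (auto simp: joint marginal dest!: param_measure_pos)
  interpret spherical_model F c a \<nu> \<pi>\<^sub>1 x u
  proof (rule spherical_model.intro)
    show "F \<in> borel_measurable borel"
      unfolding F_def using assms(2) by (rule measurable_of_radial)
    show "posterior_well_defined F c \<nu> \<pi>\<^sub>1 a x u"
      using assms(11) by (simp add: posterior_well_defined_def norm_const)
    have "(\<integral>\<^sup>+ t. ennreal (t powr (real CARD('d) + real CARD('k) / 2 + a) * F t) \<partial>pos_lborel)
        = (\<integral>\<^sup>+ t\<in>{0<..}. ennreal (t powr (real CARD('d) + real CARD('k) / 2 + a) * f t) \<partial>lborel)"
      by (subst nn_integral_restrict_space)
        (auto intro!: nn_integral_cong simp: F_def split: split_indicator)
    with assms(10)
    show "(\<integral>\<^sup>+ t. ennreal (t powr (real CARD('d) + real CARD('k) / 2 + a) * F t) \<partial>pos_lborel) < \<infinity>"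
      by simp
    show "0 \<le> F t" for t
      using assms(1) by (simp add: F_def)
  qed (fact assms)+
  have "n = b + 1"
    using assms(12) by (simp add: b_def)
  then show ?thesis
    using D_bounds predictive_eq[of y] unfolding predictive D_def Let_def by simp
qed

end
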